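(* Let $G$ be a finite group of order $m$, let $\mathcal{H}$ be a complex Hilbert space and let $U:G\to\mathcal{B}(\mathcal{H})$ be an operator-valued function. Then $U$ is a commutative unitary representation if and only if there are finitely many orthogonal projections $P_1,\dots,P_k$ and scalars $\{\lambda_i(s)\in\mathbb{T}:1\le i\le k,\ s\in G\}$ such that (1) $P_1+\dots+P_k=I_{\mathcal{H}}$ (resolution of identity); (2) $U(s)=\sum_{i=1}^k\lambda_i(s)P_i$ for all $s\in G$; (3) $\lambda_i(st)=\lambda_i(s)\lambda_i(t)$ for all $s,t\in G$ and $1\le i\le k$. Moreover, $\sigma(U(s))=\{\lambda_1(s),\dots,\lambda_k(s)\}$ for every $s\in G$.
   Context: $\mathcal{B}(\mathcal{H})$ is the algebra of bounded linear operators on $\mathcal{H}$, with identity $I_{\mathcal{H}}$; $\mathbb{T}$ is the unit circle in $\mathbb{C}$; $\sigma(\cdot)$ denotes the spectrum. A unitary representation of a group $G$ (with identity $e$) is a map $U:G\to\mathcal{B}(\mathcal{H})$ such that each $U(s)$ is unitary, $U(e)=I_{\mathcal{H}}$ and $U(s)U(t)=U(st)$ for all $s,t\in G$. It is called commutative if its image $\{U(s):s\in G\}$ consists of commuting unitaries. An orthogonal projection is a self-adjoint idempotent in $\mathcal{B}(\mathcal{H})$.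
   Formalization: The spectrum formula is stated for decompositions in which every projection P_i is nonzero (and such a decomposition is shown to exist), since it fails if some P_i = 0 with an unrelated character λ_i. *)

theory Defs
  imports "HOL-Analysis.Analysis" "HOL-Algebra.Coset"
begin

class complex_vector = real_vector +
  fixes scaleC :: "complex \<Rightarrow> 'a \<Rightarrow> 'a"  (infixr \<open>*\<^sub>C\<close> 75)
  assumes scaleC_add_right: "c *\<^sub>C (x + y) = c *\<^sub>C x + c *\<^sub>C y"
    and scaleC_add_left: "(c + d) *\<^sub>C x = c *\<^sub>C x + d *\<^sub>C x"
    and scaleC_scaleC: "c *\<^sub>C d *\<^sub>C x = (c * d) *\<^sub>C x"
    and scaleC_one: "1 *\<^sub>C x = x"
    and scaleC_of_real: "complex_of_real r *\<^sub>C x = r *\<^sub>R x"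

class complex_inner = complex_vector + real_normed_vector +
  fixes cinner :: "'a \<Rightarrow> 'a \<Rightarrow> complex"
  assumes cinner_commute: "cinner x y = cnj (cinner y x)"
    and cinner_add_left: "cinner (x + y) z = cinner x z + cinner y z"
    and cinner_scaleC_left: "cinner (c *\<^sub>C x) y = c * cinner x y"
    and cinner_ge_zero: "0 \<le> Re (cinner x x)"
    and cinner_eq_zero_iff: "cinner x x = 0 \<longleftrightarrow> x = 0"
    and norm_eq_sqrt_cinner: "norm x = sqrt (Re (cinner x x))"

class chilbert_space = complex_inner + complete_space

text \<open>The complex numbers are a Hilbert space, so the class is inhabited.\<close>

instantiation complex :: chilbert_space
begin

definition scaleC_complex :: "complex \<Rightarrow> complex \<Rightarrow> complex"
  where "scaleC_complex c x = c * x"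

definition cinner_complex :: "complex \<Rightarrow> complex \<Rightarrow> complex"
  where "cinner_complex x y = x * cnj y"

instance
  by standard
    (auto simp: scaleC_complex_def cinner_complex_def algebra_simps scaleR_conv_of_real
      cmod_def power2_eq_square)

end

text \<open>Operators are plain functions, so sums and scalar multiples of operators are
  written pointwise.\<close>

definition bounded_operators :: "('a::chilbert_space \<Rightarrow> 'a) set"
  where "bounded_operators = {T. bounded_linear T \<and> (\<forall>c x. T (c *\<^sub>C x) = c *\<^sub>C T x)}"

definition is_adjoint :: "('a::chilbert_space \<Rightarrow> 'a) \<Rightarrow> ('a \<Rightarrow> 'a) \<Rightarrow> bool"
  where "is_adjoint S T \<longleftrightarrow> (\<forall>x y. cinner (T x) y = cinner x (S y))"

text \<open>Adjoints are unique, so the existential quantifier below only names the adjoint.\<close>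

definition unitary_operator :: "('a::chilbert_space \<Rightarrow> 'a) \<Rightarrow> bool"
  where "unitary_operator T \<longleftrightarrow> T \<in> bounded_operators \<and>
    (\<exists>S\<in>bounded_operators. is_adjoint S T \<and> S \<circ> T = id \<and> T \<circ> S = id)"

definition orthogonal_projection :: "('a::chilbert_space \<Rightarrow> 'a) \<Rightarrow> bool"
  where "orthogonal_projection P \<longleftrightarrow> P \<in> bounded_operators \<and> is_adjoint P P \<and> P \<circ> P = P"

definition operator_spectrum :: "('a::chilbert_space \<Rightarrow> 'a) \<Rightarrow> complex set"
  where "operator_spectrum T = {z. \<not> (\<exists>S\<in>bounded_operators.
    S \<circ> (\<lambda>x. T x - z *\<^sub>C x) = id \<and> (\<lambda>x. T x - z *\<^sub>C x) \<circ> S = id)}"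

definition unitary_representation ::
    "('g, 'b) monoid_scheme \<Rightarrow> ('g \<Rightarrow> 'a::chilbert_space \<Rightarrow> 'a) \<Rightarrow> bool"
  where "unitary_representation G U \<longleftrightarrow>
    (\<forall>s\<in>carrier G. unitary_operator (U s)) \<and> U \<one>\<^bsub>G\<^esub> = id \<and>
    (\<forall>s\<in>carrier G. \<forall>t\<in>carrier G. U s \<circ> U t = U (s \<otimes>\<^bsub>G\<^esub> t))"

definition commutative_unitary_representation ::
    "('g, 'b) monoid_scheme \<Rightarrow> ('g \<Rightarrow> 'a::chilbert_space \<Rightarrow> 'a) \<Rightarrow> bool"
  where "commutative_unitary_representation G U \<longleftrightarrow> unitary_representation G U \<and>
    (\<forall>s\<in>carrier G. \<forall>t\<in>carrier G. U s \<circ> U t = U t \<circ> U s)"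

definition diagonal_decomposition ::
    "('g, 'b) monoid_scheme \<Rightarrow> ('g \<Rightarrow> 'a::chilbert_space \<Rightarrow> 'a) \<Rightarrow>
      nat \<Rightarrow> (nat \<Rightarrow> 'a \<Rightarrow> 'a) \<Rightarrow> (nat \<Rightarrow> 'g \<Rightarrow> complex) \<Rightarrow> bool"
  where "diagonal_decomposition G U k P lam \<longleftrightarrow>
    (\<forall>i\<in>{1..k}. orthogonal_projection (P i)) \<and>
    (\<forall>i\<in>{1..k}. \<forall>s\<in>carrier G. lam i s \<in> sphere 0 1) \<and>
    (\<forall>x. (\<Sum>i=1..k. P i x) = x) \<and>
    (\<forall>s\<in>carrier G. \<forall>x. U s x = (\<Sum>i=1..k. lam i s *\<^sub>C P i x)) \<and>
    (\<forall>i\<in>{1..k}. \<forall>s\<in>carrier G. \<forall>t\<in>carrier G. lam i (s \<otimes>\<^bsub>G\<^esub> t) = lam i s * lam i t)"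

end

theory Submission
  imports Defs "HOL-Algebra.Multiplicative_Group"
begin

text \<open>For a commutative unitary representation, \<open>P \<phi> = (1/m) \<Sum>s. cnj (\<phi> s) U s\<close>
  is the orthogonal projection onto the joint eigenspace of the character \<open>\<phi>\<close>. These finitely
  many projections add up to the identity because the vectors on which they do so form a
  subspace that contains every joint eigenvector, and joint eigenvectors span: as \<open>U a\<close> has
  finite order and commutes with the other operators, a discrete Fourier transform over the powers
  of \<open>a\<close> splits a vector into eigenvectors of \<open>U a\<close> without losing the eigenvector property for
  the other group elements. Conversely, projections that add up to the identity are mutually
  orthogonal, so \<open>f \<mapsto> \<Sum>i. f i P i\<close> is a unital *-homomorphism, from which the representation
  property and the spectrum are read off.\<close>

section \<open>Complex inner product spaces and bounded operators\<close>

interpretation complex_vector: vector_space "scaleC :: complex \<Rightarrow> 'a \<Rightarrow> 'a::complex_vector"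
  by unfold_locales (simp_all add: scaleC_add_right scaleC_add_left scaleC_scaleC scaleC_one)

lemma scaleR_eq_scaleC: "r *\<^sub>R x = complex_of_real r *\<^sub>C (x::'a::complex_vector)"
  by (simp add: scaleC_of_real)

lemma scaleC_scaleR_commute: "c *\<^sub>C (r *\<^sub>R x) = r *\<^sub>R (c *\<^sub>C (x::'a::complex_vector))"
  by (simp add: scaleR_eq_scaleC mult.commute)

lemma cinner_zero_left [simp]: "cinner 0 (y::'a::complex_inner) = 0"
  using cinner_scaleC_left[of 0 0 y] by simp

lemma cinner_zero_right [simp]: "cinner (x::'a::complex_inner) 0 = 0"
  using cinner_commute[of x 0] by simp

lemma cinner_add_right: "cinner x (y + z) = cinner x y + cinner x (z::'a::complex_inner)"
  by (metis cinner_add_left cinner_commute complex_cnj_add)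

lemma cinner_scaleC_right: "cinner x (c *\<^sub>C y) = cnj c * cinner x (y::'a::complex_inner)"
  by (metis cinner_commute cinner_scaleC_left complex_cnj_mult)

lemma cinner_sum_left: "cinner (\<Sum>i\<in>I. f i) (y::'a::complex_inner) = (\<Sum>i\<in>I. cinner (f i) y)"
  by (induction I rule: infinite_finite_induct) (simp_all add: cinner_add_left)

lemma cinner_sum_right: "cinner (x::'a::complex_inner) (\<Sum>i\<in>I. f i) = (\<Sum>i\<in>I. cinner x (f i))"
  by (induction I rule: infinite_finite_induct) (simp_all add: cinner_add_right)

lemma Re_cinner_self: "Re (cinner x x) = (norm (x::'a::complex_inner))\<^sup>2"
  by (simp add: norm_eq_sqrt_cinner cinner_ge_zero)

text \<open>The classes give homogeneity of the norm for real scalars only; the complex case comes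
  from sesquilinearity of the inner product.\<close>

lemma norm_scaleC: "norm (c *\<^sub>C x) = cmod c * norm (x::'a::complex_inner)"
proof -
  have "cinner (c *\<^sub>C x) (c *\<^sub>C x) = complex_of_real ((cmod c)\<^sup>2) * cinner x x"
    by (simp add: cinner_scaleC_left cinner_scaleC_right complex_norm_square mult.assoc
        flip: of_real_power)
  then have "(norm (c *\<^sub>C x))\<^sup>2 = (cmod c * norm x)\<^sup>2"
    by (simp add: power_mult_distrib flip: Re_cinner_self of_real_power)
  then show ?thesis
    by (simp add: power2_eq_iff_nonneg)
qed

lemma bounded_linear_scaleC: "bounded_linear (\<lambda>x::'a::complex_inner. c *\<^sub>C x)"
  by (rule bounded_linear_intro[of _ "cmod c"])
    (simp_all add: scaleC_add_right scaleC_scaleR_commute norm_scaleC mult.commute)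

lemma bounded_operators_linear:
  assumes "T \<in> bounded_operators"
  shows "linear T"
  using assms by (simp add: bounded_operators_def bounded_linear.linear)

lemma bounded_operators_scaleC:
  "T \<in> bounded_operators \<Longrightarrow> T (c *\<^sub>C x) = c *\<^sub>C T x"
  by (simp add: bounded_operators_def)

lemma bounded_operators_combination:
  assumes "\<And>i. i \<in> I \<Longrightarrow> T i \<in> bounded_operators"
  shows "(\<lambda>x. \<Sum>i\<in>I. f i *\<^sub>C T i x) \<in> bounded_operators"
proof -
  have "bounded_linear (\<lambda>x. f i *\<^sub>C T i x)" if "i \<in> I" for i
    using bounded_linear_compose[OF bounded_linear_scaleC, of "T i" "f i"] assms[OF that]
    by (simp add: bounded_operators_def)
  then show ?thesis
    using assms
    by (auto simp: bounded_operators_def bounded_linear_sum complex_vector.scale_sum_right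
        mult.commute intro!: sum.cong)
qed

section \<open>Resolutions of the identity\<close>

text \<open>Mutual orthogonality of the projections is derived from these assumptions in
  \<open>orthogonal\<close>.\<close>

locale resolution_of_identity =
  fixes I :: "'i set" and P :: "'i \<Rightarrow> 'a::chilbert_space \<Rightarrow> 'a"
  assumes finite_index: "finite I"
    and projection: "i \<in> I \<Longrightarrow> orthogonal_projection (P i)"
    and sum_projections: "(\<Sum>i\<in>I. P i x) = x"
begin

definition diagonal :: "('i \<Rightarrow> complex) \<Rightarrow> 'a \<Rightarrow> 'a"
  where "diagonal f x = (\<Sum>i\<in>I. f i *\<^sub>C P i x)"

lemma bounded: "i \<in> I \<Longrightarrow> P i \<in> bounded_operators"
  and self_adjoint: "i \<in> I \<Longrightarrow> cinner (P i x) y = cinner x (P i y)"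
  and idem: "i \<in> I \<Longrightarrow> P i (P i x) = P i x"
  using projection by (auto simp: orthogonal_projection_def is_adjoint_def fun_eq_iff)

text \<open>Pythagoras: \<open>(norm x)\<^sup>2 = (\<Sum>i\<in>I. (norm (P i x))\<^sup>2)\<close>; for \<open>x\<close> in the range of \<open>P j\<close>
  the summand of \<open>j\<close> already exhausts the left-hand side.\<close>

lemma orthogonal:
  assumes "i \<in> I" "j \<in> I" "i \<noteq> j"
  shows "P i (P j x) = 0"
proof -
  define y where "y = P j x"
  have "cinner y y = (\<Sum>i\<in>I. cinner (P i y) y)"
    by (simp add: sum_projections flip: cinner_sum_left)
  also have "\<dots> = (\<Sum>i\<in>I. cinner (P i y) (P i y))"
    by (rule sum.cong) (simp_all add: idem flip: self_adjoint)
  finally have "(norm y)\<^sup>2 = (\<Sum>i\<in>I. (norm (P i y))\<^sup>2)"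
    by (simp flip: Re_cinner_self)
  also have "\<dots> = (norm (P j y))\<^sup>2 + (\<Sum>i\<in>I - {j}. (norm (P i y))\<^sup>2)"
    by (rule sum.remove) (use assms finite_index in auto)
  finally have "(\<Sum>i\<in>I - {j}. (norm (P i y))\<^sup>2) = 0"
    using assms by (simp add: y_def idem)
  then show ?thesis
    using assms finite_index by (simp add: sum_nonneg_eq_0_iff y_def)
qed

lemma diagonal_bounded: "diagonal f \<in> bounded_operators"
  unfolding diagonal_def[abs_def] by (rule bounded_operators_combination) (rule bounded)

text \<open>By orthogonality \<open>P i\<close> annihilates every summand except the one of
  \<open>i\<close>.\<close>

lemma projection_diagonal:
  assumes "i \<in> I"
  shows "P i (diagonal f x) = f i *\<^sub>C P i x"
proof -
  have "P i (diagonal f x) = (\<Sum>j\<in>I. f j *\<^sub>C P i (P j x))"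
    using assms bounded
    by (simp add: diagonal_def linear_sum[OF bounded_operators_linear] bounded_operators_scaleC)
  also have "\<dots> = (\<Sum>j\<in>I. if j = i then f i *\<^sub>C P i x else 0)"
    using assms by (intro sum.cong) (auto simp: idem orthogonal)
  finally show ?thesis
    using assms finite_index by simp
qed

lemma diagonal_mult: "diagonal f (diagonal g x) = diagonal (\<lambda>i. f i * g i) x"
  \<comment> \<open>The inner \<open>diagonal g x\<close> has to stay folded for
    \<open>projection_diagonal\<close> to match it.\<close>
  by (simp add: diagonal_def[of f] diagonal_def[of "\<lambda>i. f i * g i"] projection_diagonal)

lemma diagonal_eq_id:
  assumes "\<And>i. i \<in> I \<Longrightarrow> f i = 1"
  shows "diagonal f x = x"
  using assms by (simp add: diagonal_def sum_projections)

lemma diagonal_adjoint: "is_adjoint (diagonal (\<lambda>i. cnj (f i))) (diagonal f)"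
  by (simp add: is_adjoint_def diagonal_def cinner_sum_left cinner_sum_right cinner_scaleC_left
      cinner_scaleC_right self_adjoint)

text \<open>On the unit circle conjugation is inversion, so the adjoint given by the conjugate
  symbol is also the inverse.\<close>

lemma diagonal_unitary:
  assumes "\<And>i. i \<in> I \<Longrightarrow> cmod (f i) = 1"
  shows "unitary_operator (diagonal f)"
proof -
  have "f i * cnj (f i) = 1" if "i \<in> I" for i
    using assms[OF that] by (simp flip: complex_norm_square)
  then show ?thesis
    unfolding unitary_operator_def
    by (intro conjI bexI[of _ "diagonal (\<lambda>i. cnj (f i))"] diagonal_adjoint diagonal_bounded)
      (simp_all add: fun_eq_iff diagonal_mult diagonal_eq_id mult.commute)
qed

lemma diagonal_diff_scalar: "diagonal f x - z *\<^sub>C x = diagonal (\<lambda>i. f i - z) x"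
proof -
  have "z *\<^sub>C x = (\<Sum>i\<in>I. z *\<^sub>C P i x)"
    by (simp add: sum_projections flip: complex_vector.scale_sum_right)
  then show ?thesis
    by (simp add: diagonal_def complex_vector.scale_left_diff_distrib sum_subtractf)
qed

text \<open>Away from the values of \<open>f\<close> the resolvent is again diagonal. At a value
  \<open>f i\<close>, a nonzero vector in the range of \<open>P i\<close> is an eigenvector, so no
  left inverse exists; the hypothesis supplies such a vector.\<close>

lemma spectrum_diagonal:
  assumes "\<And>i. i \<in> I \<Longrightarrow> P i \<noteq> (\<lambda>x. 0)"
  shows "operator_spectrum (diagonal f) = f ` I"
proof (intro equalityI subsetI)
  fix z assume z: "z \<in> operator_spectrum (diagonal f)"
  show "z \<in> f ` I"
  proof (rule ccontr)
    assume "z \<notin> f ` I"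
    then have nz: "f i \<noteq> z" if "i \<in> I" for i
      using that by auto
    let ?S = "diagonal (\<lambda>i. inverse (f i - z))"
    have "?S \<circ> (\<lambda>x. diagonal f x - z *\<^sub>C x) = id" "(\<lambda>x. diagonal f x - z *\<^sub>C x) \<circ> ?S = id"
      by (auto simp: fun_eq_iff diagonal_diff_scalar diagonal_mult nz intro!: diagonal_eq_id)
    with z show False
      using diagonal_bounded by (auto simp: operator_spectrum_def)
  qed
next
  fix z assume "z \<in> f ` I"
  then obtain i where i: "i \<in> I" "z = f i" by auto
  then obtain x where x: "P i x \<noteq> 0"
    using assms by (auto simp: fun_eq_iff)
  have "diagonal f (P i x) = (\<Sum>j\<in>I. if j = i then f i *\<^sub>C P i x else 0)"
    unfolding diagonal_def using i by (intro sum.cong) (auto simp: idem orthogonal)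
  then have eig: "diagonal f (P i x) - z *\<^sub>C P i x = 0"
    using i finite_index by simp
  have "S \<circ> (\<lambda>x. diagonal f x - z *\<^sub>C x) \<noteq> id" if "S \<in> bounded_operators" for S
  proof
    assume "S \<circ> (\<lambda>x. diagonal f x - z *\<^sub>C x) = id"
    then have "P i x = S (diagonal f (P i x) - z *\<^sub>C P i x)"
      by (metis comp_apply id_apply)
    with eig x show False
      using linear_0[OF bounded_operators_linear[OF that]] by simp
  qed
  then show "z \<in> operator_spectrum (diagonal f)"
    by (auto simp: operator_spectrum_def)
qed

end

section \<open>Consequences of a diagonal decomposition\<close>

lemma diagonal_decomposition_resolution:
  assumes "diagonal_decomposition G U k P lam"
  shows "resolution_of_identity {1..k} P"
    and "s \<in> carrier G \<Longrightarrow>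
      U s = resolution_of_identity.diagonal {1..k} P (\<lambda>i. lam i s)"
proof -
  show R: "resolution_of_identity {1..k} P"
    using assms by unfold_locales (auto simp: diagonal_decomposition_def)
  show "U s = resolution_of_identity.diagonal {1..k} P (\<lambda>i. lam i s)" if "s \<in> carrier G"
    using assms that
    by (simp add: fun_eq_iff diagonal_decomposition_def
        resolution_of_identity.diagonal_def[OF R] del: One_nat_def)
qed

lemma diagonal_decomposition_spectrum:
  assumes D: "diagonal_decomposition G U k P lam"
    and "\<forall>i\<in>{1..k}. P i \<noteq> (\<lambda>x. 0)" and "s \<in> carrier G"
  shows "operator_spectrum (U s) = {lam i s | i. i \<in> {1..k}}"
  using assms
    resolution_of_identity.spectrum_diagonal[OF diagonal_decomposition_resolution(1)[OF D]]
  by (auto simp: diagonal_decomposition_resolution(2)[OF D])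

lemma diagonal_decomposition_imp_representation:
  assumes "group G" and D: "diagonal_decomposition G U k P lam"
  shows "commutative_unitary_representation G U"
proof -
  interpret group G by fact
  interpret R: resolution_of_identity "{1..k}" P
    by (rule diagonal_decomposition_resolution(1)[OF D])
  \<comment> \<open>Otherwise \<open>{1..k}\<close> turns into \<open>{Suc 0..k}\<close> and no
    longer matches the interpretation.\<close>
  note [simp del] = One_nat_def
  note U = diagonal_decomposition_resolution(2)[OF D]
  have norm1: "cmod (lam i s) = 1" if "i \<in> {1..k}" "s \<in> carrier G" for i s
    using D that by (auto simp: diagonal_decomposition_def)
  have mult: "lam i (s \<otimes>\<^bsub>G\<^esub> t) = lam i s * lam i t"
    if "i \<in> {1..k}" "s \<in> carrier G" "t \<in> carrier G" for i s t
    using D that by (auto simp: diagonal_decomposition_def)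
  \<comment> \<open>The value at the unit equals its own square, and modulus 1 excludes 0.\<close>
  have one: "lam i \<one>\<^bsub>G\<^esub> = 1" if "i \<in> {1..k}" for i
    using mult[OF that one_closed one_closed] norm1[OF that one_closed] by auto
  have "U \<one>\<^bsub>G\<^esub> = id"
    unfolding fun_eq_iff U[OF one_closed] id_apply by (intro allI R.diagonal_eq_id one)
  moreover have "U s \<circ> U t = U (s \<otimes>\<^bsub>G\<^esub> t)" if "s \<in> carrier G" "t \<in> carrier G" for s t
  proof
    fix x
    show "(U s \<circ> U t) x = U (s \<otimes>\<^bsub>G\<^esub> t) x"
      using that by (simp add: U R.diagonal_mult) (simp add: R.diagonal_def mult)
  qed
  moreover have "U s \<circ> U t = U t \<circ> U s" if "s \<in> carrier G" "t \<in> carrier G" for s t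
    using that by (simp add: fun_eq_iff U R.diagonal_mult mult.commute)
  moreover have "unitary_operator (U s)" if "s \<in> carrier G" for s
    unfolding U[OF that] using norm1 that by (intro R.diagonal_unitary)
  ultimately show ?thesis
    by (simp add: commutative_unitary_representation_def unitary_representation_def)
qed

section \<open>Characters of a finite group\<close>

text \<open>Extensionality makes the set of characters finite.\<close>

definition characters :: "('g, 'b) monoid_scheme \<Rightarrow> ('g \<Rightarrow> complex) set"
  where "characters G = {\<phi> \<in> carrier G \<rightarrow>\<^sub>E UNIV. \<phi> \<one>\<^bsub>G\<^esub> = 1 \<and>
    (\<forall>s\<in>carrier G. \<forall>t\<in>carrier G. \<phi> (s \<otimes>\<^bsub>G\<^esub> t) = \<phi> s * \<phi> t)}"

locale finite_group = group G for G (structure) +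
  assumes finite_carrier: "finite (carrier G)"
begin

lemma order_pos: "0 < order G"
  using finite_carrier by (simp add: order_gt_0_iff_finite)

lemma sum_translate:
  assumes "t \<in> carrier G"
  shows "(\<Sum>s\<in>carrier G. f (t \<otimes> s)) = (\<Sum>s\<in>carrier G. f s)"
  using assms
  by (intro sum.reindex_bij_witness[of _ "\<lambda>s. inv t \<otimes> s" "\<lambda>s. t \<otimes> s"])
    (auto simp: inv_solve_left m_assoc[symmetric])

lemma sum_inverse: "(\<Sum>s\<in>carrier G. f (inv s)) = (\<Sum>s\<in>carrier G. f s)"
  by (intro sum.reindex_bij_witness[of _ "\<lambda>s. inv s" "\<lambda>s. inv s"]) auto

lemma character_one: "\<phi> \<in> characters G \<Longrightarrow> \<phi> \<one> = 1"
  and character_mult: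
    "\<phi> \<in> characters G \<Longrightarrow> s \<in> carrier G \<Longrightarrow> t \<in> carrier G \<Longrightarrow> \<phi> (s \<otimes> t) = \<phi> s * \<phi> t"
  by (auto simp: characters_def)

lemma character_extensional: "\<phi> \<in> characters G \<Longrightarrow> \<phi> \<in> extensional (carrier G)"
  by (simp add: characters_def PiE_iff)

lemma character_pow:
  assumes "\<phi> \<in> characters G" "s \<in> carrier G"
  shows "\<phi> (s [^] (n::nat)) = \<phi> s ^ n"
  using assms by (induction n) (simp_all add: character_one character_mult)

lemma character_root_of_unity:
  assumes "\<phi> \<in> characters G" "s \<in> carrier G"
  shows "\<phi> s ^ order G = 1"
  using assms by (simp add: pow_order_eq_1 character_one flip: character_pow)

text \<open>By Lagrange all values are roots of unity of order dividing \<open>order G\<close>,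
  which leaves finitely many extensional functions.\<close>

lemma finite_characters: "finite (characters G)"
proof (rule finite_subset)
  show "characters G \<subseteq> carrier G \<rightarrow>\<^sub>E {z. z ^ order G = 1}"
  proof
    fix \<phi> assume "\<phi> \<in> characters G"
    then show "\<phi> \<in> carrier G \<rightarrow>\<^sub>E {z. z ^ order G = 1}"
      using character_root_of_unity character_extensional by (simp add: PiE_iff)
  qed
  show "finite (carrier G \<rightarrow>\<^sub>E {z::complex. z ^ order G = 1})"
    using order_pos by (intro finite_PiE finite_carrier finite_roots_unity) simp
qed

lemma norm_character:
  assumes "\<phi> \<in> characters G" "s \<in> carrier G"
  shows "cmod (\<phi> s) = 1"
  using power_eq_1_iff[OF character_root_of_unity[OF assms]] order_pos by simp

lemma character_mult_cnj:
  assumes "\<phi> \<in> characters G" "s \<in> carrier G"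
  shows "cnj (\<phi> s) * \<phi> s = 1"
  using norm_character[OF assms] by (simp add: mult.commute flip: complex_norm_square)

lemma character_inv:
  assumes "\<phi> \<in> characters G" "s \<in> carrier G"
  shows "\<phi> (inv s) = cnj (\<phi> s)"
proof -
  have "\<phi> (inv s) * \<phi> s = 1"
    using assms by (simp add: character_one flip: character_mult)
  then show ?thesis
    using character_mult_cnj[OF assms] by (metis mult_cancel_right mult_zero_right zero_neq_one)
qed

text \<open>Translating the sum by a point \<open>t\<close> where the characters differ multiplies
  it by \<open>cnj (\<phi> t) * \<psi> t\<close>, a factor different from 1.\<close>

lemma character_orthogonality:
  assumes "\<phi> \<in> characters G" "\<psi> \<in> characters G" "\<phi> \<noteq> \<psi>"
  shows "(\<Sum>s\<in>carrier G. cnj (\<phi> s) * \<psi> s) = 0"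
proof -
  \<comment> \<open>Both functions are extensional, so they must differ somewhere inside the
    carrier.\<close>
  have "\<exists>t\<in>carrier G. \<phi> t \<noteq> \<psi> t"
    using assms extensionalityI[OF character_extensional character_extensional] by blast
  then obtain t where t: "t \<in> carrier G" "\<phi> t \<noteq> \<psi> t" by blast
  let ?S = "\<Sum>s\<in>carrier G. cnj (\<phi> s) * \<psi> s"
  have "?S = (\<Sum>s\<in>carrier G. cnj (\<phi> (t \<otimes> s)) * \<psi> (t \<otimes> s))"
    using t by (simp add: sum_translate[where f = "\<lambda>s. cnj (\<phi> s) * \<psi> s"])
  also have "\<dots> = cnj (\<phi> t) * \<psi> t * ?S"
    using assms t by (simp add: sum_distrib_left character_mult mult_ac)
  finally have "\<phi> t * ?S = \<phi> t * (cnj (\<phi> t) * \<psi> t * ?S)"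
    by (rule arg_cong)
  also have "\<dots> = (cnj (\<phi> t) * \<phi> t) * (\<psi> t * ?S)"
    by (simp only: mult_ac)
  also have "\<dots> = \<psi> t * ?S"
    using t assms by (simp only: character_mult_cnj mult_1)
  finally show ?thesis
    using t by (simp only: mult_cancel_right) simp
qed

end

section \<open>Joint eigenspaces of a commutative unitary representation\<close>

text \<open>For \<open>j \<noteq> 0\<close> the ratio is an \<open>m\<close>-th root of unity other
  than 1, because \<open>m\<close> does not divide \<open>j\<close>; the geometric sum therefore
  vanishes.\<close>

lemma sum_roots_of_unity:
  fixes j m :: nat
  assumes "j < m"
  shows "(\<Sum>k<m. cis (2 * pi * real j / real m) ^ k) = (if j = 0 then of_nat m else 0)"
proof (cases "j = 0")
  case False
  let ?z = "cis (2 * pi * real j / real m)"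
  have "?z \<noteq> 1"
  proof
    assume "?z = 1"
    then have "cos (2 * pi * real j / real m) = 1"
      by (simp add: complex_eq_iff)
    then obtain n :: int where "2 * pi * real j / real m = of_int n * 2 * pi"
      by (auto simp: cos_one_2pi_int)
    then have "real_of_int (int j) = of_int (n * int m)"
      using assms by (simp add: field_simps)
    then have "int j = n * int m"
      by (simp only: of_int_eq_iff)
    then have "m dvd j"
      by (metis dvd_triv_right int_dvd_int_iff)
    then show False
      using assms False by (auto dest: dvd_imp_le)
  qed
  moreover have "?z ^ m = 1"
    using assms cis_multiple_2pi[of "real j"] by (simp only: Complex.DeMoivre) (simp add: mult_ac)
  ultimately show ?thesis
    using False by (simp add: geometric_sum)
qed simp

locale commutative_representation = finite_group G for G (structure) +
  fixes U :: "'a \<Rightarrow> 'h::chilbert_space \<Rightarrow> 'h"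
  assumes representation: "commutative_unitary_representation G U"
begin

lemma U_bounded: "s \<in> carrier G \<Longrightarrow> U s \<in> bounded_operators"
  and U_one: "U \<one> x = x"
  and U_mult: "s \<in> carrier G \<Longrightarrow> t \<in> carrier G \<Longrightarrow> U s (U t x) = U (s \<otimes> t) x"
  and U_commute: "s \<in> carrier G \<Longrightarrow> t \<in> carrier G \<Longrightarrow> U s (U t x) = U t (U s x)"
  using representation
  by (auto simp: commutative_unitary_representation_def unitary_representation_def
      unitary_operator_def fun_eq_iff)

lemma U_sum: "s \<in> carrier G \<Longrightarrow> U s (\<Sum>i\<in>I. f i) = (\<Sum>i\<in>I. U s (f i))"
  and U_scaleC: "s \<in> carrier G \<Longrightarrow> U s (c *\<^sub>C x) = c *\<^sub>C U s x"
  using U_bounded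
  by (auto simp: linear_sum bounded_operators_linear bounded_operators_scaleC)

lemma U_adjoint:
  assumes "s \<in> carrier G"
  shows "cinner (U s x) y = cinner x (U (inv s) y)"
proof -
  obtain S where S: "is_adjoint S (U s)" "S \<circ> U s = id"
    using representation assms
    by (auto simp: commutative_unitary_representation_def unitary_representation_def
        unitary_operator_def)
  \<comment> \<open>The adjoint is a left inverse of \<open>U s\<close>, and
    \<open>U (inv s)\<close> is a right inverse, so the two agree.\<close>
  have "S y = S (U s (U (inv s) y))"
    using assms by (simp add: U_mult U_one)
  also have "\<dots> = U (inv s) y"
    using S(2) by (metis comp_apply id_apply)
  finally show ?thesis
    using S(1) by (simp add: is_adjoint_def)
qed

text \<open>The component of \<open>x\<close> in the eigenspace of \<open>U a\<close> for the
  \<open>k\<close>-th root of unity. Using \<open>order G\<close> instead of the order of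
  \<open>a\<close> gives one index range for all \<open>a\<close>.\<close>

definition fourier :: "'a \<Rightarrow> nat \<Rightarrow> 'h \<Rightarrow> 'h"
  where "fourier a k x =
    (\<Sum>j<order G. cnj (cis (2 * pi * real j / real (order G)) ^ k / of_nat (order G)) *\<^sub>C
      U (a [^] j) x)"

text \<open>After exchanging the sums, the roots of unity cancel all powers of \<open>a\<close>
  except \<open>a [^] 0\<close>.\<close>

lemma sum_fourier:
  assumes "a \<in> carrier G"
  shows "(\<Sum>k<order G. fourier a k x) = x"
proof -
  let ?z = "\<lambda>j. cis (2 * pi * real j / real (order G))"
  have "(\<Sum>k<order G. fourier a k x) =
      (\<Sum>j<order G. cnj ((\<Sum>k<order G. ?z j ^ k) / of_nat (order G)) *\<^sub>C U (a [^] j) x)"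
    unfolding fourier_def
    by (subst sum.swap) (simp add: complex_vector.scale_sum_left sum_divide_distrib)
  also have "\<dots> = (\<Sum>j<order G. if j = 0 then x else 0)"
    using order_pos by (intro sum.cong) (auto simp: sum_roots_of_unity U_one)
  finally show ?thesis
    using order_pos by simp
qed

text \<open>Applying \<open>U a\<close> shifts the powers of \<open>a\<close> by one, which costs a
  factor \<open>w\<close>; the shift is cyclic since \<open>g\<close> has equal values at 0 and at
  \<open>order G\<close>.\<close>

lemma U_fourier:
  assumes "a \<in> carrier G"
  shows "U a (fourier a k x) = cis (2 * pi * real k / real (order G)) *\<^sub>C fourier a k x"
proof -
  let ?m = "order G"
  define w where "w = cis (2 * pi * real k / real ?m)"
  define g where "g j = cnj (w ^ j / of_nat ?m) *\<^sub>C U (a [^] j) x" for j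
  have w: "w * cnj w = 1"
    by (simp add: w_def flip: complex_norm_square)
  have "cis (2 * pi * real j / real ?m) ^ k = w ^ j" for j
    by (simp only: w_def Complex.DeMoivre) (simp add: mult_ac)
  then have fourier: "fourier a k x = (\<Sum>j<?m. g j)"
    by (simp add: fourier_def g_def)
  have "w ^ ?m = 1"
    using order_pos cis_multiple_2pi[of "real k"]
    by (simp only: w_def Complex.DeMoivre) (simp add: mult_ac)
  then have "g ?m = g 0"
    using assms by (simp add: g_def pow_order_eq_1)
  have "U a (g j) = w *\<^sub>C g (Suc j)" for j
  proof -
    have "w *\<^sub>C g (Suc j) = (w * cnj w * cnj (w ^ j / of_nat ?m)) *\<^sub>C U (a [^] Suc j) x"
      by (simp add: g_def mult_ac)
    also have "U (a [^] Suc j) x = U a (U (a [^] j) x)"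
      using assms by (simp only: U_mult nat_pow_Suc2 nat_pow_closed)
    finally show ?thesis
      using assms by (simp add: w g_def U_scaleC)
  qed
  then have "U a (fourier a k x) = w *\<^sub>C (\<Sum>j<?m. g (Suc j))"
    using assms by (simp add: fourier U_sum complex_vector.scale_sum_right)
  also have "(\<Sum>j<?m. g (Suc j)) = (\<Sum>j<?m. g j)"
    \<comment> \<open>Both sums arise from the sum over \<open>{..<Suc ?m}\<close> by dropping one
      of the equal end terms.\<close>
    using sum.lessThan_Suc_shift[of g ?m] \<open>g ?m = g 0\<close> by simp
  finally show ?thesis
    by (simp add: fourier w_def)
qed

text \<open>Here commutativity enters: the powers of \<open>U a\<close> preserve each eigenspace of
  \<open>U s\<close>.\<close>

lemma fourier_eigenvector:
  assumes "a \<in> carrier G" "s \<in> carrier G" "U s x = c *\<^sub>C x"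
  shows "U s (fourier a k x) = c *\<^sub>C fourier a k x"
proof -
  have "U s (U (a [^] j) x) = c *\<^sub>C U (a [^] j) x" for j :: nat
    using assms by (simp add: U_commute[of s] U_scaleC)
  then show ?thesis
    using assms
    by (simp add: fourier_def U_sum U_scaleC complex_vector.scale_sum_right mult.commute)
qed

text \<open>This expresses that joint eigenvectors span, in a form that serves as an induction
  rule.\<close>

lemma joint_eigenvector_induct:
  assumes add: "\<And>I (f :: nat \<Rightarrow> 'h). (\<And>i. i \<in> I \<Longrightarrow> Q (f i)) \<Longrightarrow> Q (\<Sum>i\<in>I. f i)"
    and eigen: "\<And>x. (\<And>s. s \<in> carrier G \<Longrightarrow> \<exists>c. U s x = c *\<^sub>C x) \<Longrightarrow> Q x"
  shows "Q x"
proof -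
  \<comment> \<open>Induction on \<open>A\<close> discharges the eigenvector requirements one by
    one: \<open>A\<close> starts as the whole carrier, and for empty \<open>A\<close> nothing is
    required of \<open>x\<close>.\<close>
  have "\<forall>x. Q x"
    if "finite A" "A \<subseteq> carrier G" "\<forall>x. (\<forall>s\<in>A. \<exists>c. U s x = c *\<^sub>C x) \<longrightarrow> Q x" for A
    using that
  proof (induction A rule: finite_induct)
    case (insert a A)
    have "Q x" if x: "\<forall>s\<in>A. \<exists>c. U s x = c *\<^sub>C x" for x
    proof -
      have a: "a \<in> carrier G" and A: "A \<subseteq> carrier G"
        using insert.prems by auto
      \<comment> \<open>Each component keeps the eigenvector property for \<open>A\<close> and gains
        it for \<open>a\<close>.\<close>
      have "Q (fourier a k x)" for k
      proof -
        have "\<exists>c. U s (fourier a k x) = c *\<^sub>C fourier a k x" if "s \<in> A" for s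
          using x A that fourier_eigenvector[OF a] by blast
        moreover have "\<exists>c. U a (fourier a k x) = c *\<^sub>C fourier a k x"
          using U_fourier[OF a] by blast
        ultimately show ?thesis
          using insert.prems(2) by blast
      qed
      then have "Q (\<Sum>k<order G. fourier a k x)"
        by (intro add)
      then show ?thesis
        by (simp add: sum_fourier a)
    qed
    then show ?case
      using insert by auto
  qed auto
  from this[OF finite_carrier order_refl] eigen show ?thesis by blast
qed

section \<open>Isotypic projections\<close>

definition isotypic :: "('a \<Rightarrow> complex) \<Rightarrow> 'h \<Rightarrow> 'h"
  where "isotypic \<phi> x = (\<Sum>s\<in>carrier G. (cnj (\<phi> s) / of_nat (order G)) *\<^sub>C U s x)"

lemma isotypic_bounded: "isotypic \<phi> \<in> bounded_operators"
  unfolding isotypic_def[abs_def] by (rule bounded_operators_combination) (rule U_bounded)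

text \<open>Translating the average by \<open>t\<close> produces a factor
  \<open>cnj (\<phi> t)\<close>, which cancels \<open>\<phi> t\<close>.\<close>

lemma U_isotypic:
  assumes \<phi>: "\<phi> \<in> characters G" and t: "t \<in> carrier G"
  shows "U t (isotypic \<phi> x) = \<phi> t *\<^sub>C isotypic \<phi> x"
proof -
  let ?m = "of_nat (order G) :: complex"
  have "\<phi> t *\<^sub>C isotypic \<phi> x = \<phi> t *\<^sub>C (\<Sum>s\<in>carrier G. (cnj (\<phi> (t \<otimes> s)) / ?m) *\<^sub>C U (t \<otimes> s) x)"
    using t by (simp add: isotypic_def sum_translate[where f = "\<lambda>s. (cnj (\<phi> s) / ?m) *\<^sub>C U s x"])
  also have "\<dots> = (\<Sum>s\<in>carrier G. ((cnj (\<phi> t) * \<phi> t) * (cnj (\<phi> s) / ?m)) *\<^sub>C U (t \<otimes> s) x)"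
    using assms by (simp add: complex_vector.scale_sum_right character_mult mult_ac)
  also have "\<dots> = U t (isotypic \<phi> x)"
    using assms by (simp add: isotypic_def character_mult_cnj U_sum U_scaleC U_mult)
  finally show ?thesis by simp
qed

text \<open>On a joint eigenvector the average becomes a scalar, and orthogonality of characters
  evaluates it.\<close>

lemma isotypic_eigenvector:
  assumes "\<phi> \<in> characters G" "\<psi> \<in> characters G"
    and "\<And>s. s \<in> carrier G \<Longrightarrow> U s x = \<psi> s *\<^sub>C x"
  shows "isotypic \<phi> x = (if \<phi> = \<psi> then x else 0)"
proof -
  have "isotypic \<phi> x = ((\<Sum>s\<in>carrier G. cnj (\<phi> s) * \<psi> s) / of_nat (order G)) *\<^sub>C x"
    using assms(3) by (simp add: isotypic_def complex_vector.scale_sum_left sum_divide_distrib)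
  moreover have "(\<Sum>s\<in>carrier G. cnj (\<psi> s) * \<psi> s) = of_nat (order G)"
    using assms by (simp add: character_mult_cnj order_def)
  ultimately show ?thesis
    using assms character_orthogonality order_pos by auto
qed

text \<open>Idempotent because its range consists of joint eigenvectors for \<phi>; self-adjoint by
  the substitution of \<open>inv s\<close> for \<open>s\<close>.\<close>

lemma isotypic_projection:
  assumes \<phi>: "\<phi> \<in> characters G"
  shows "orthogonal_projection (isotypic \<phi>)"
proof -
  have "isotypic \<phi> (isotypic \<phi> x) = isotypic \<phi> x" for x
    using isotypic_eigenvector[OF \<phi> \<phi>] U_isotypic[OF \<phi>] by simp
  moreover have "cinner (isotypic \<phi> x) y = cinner x (isotypic \<phi> y)" for x y
  proof -
    \<comment> \<open>The summand of the right-hand side; at \<open>inv s\<close> it is the summand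
      of the left-hand side.\<close>
    let ?f = "\<lambda>s. \<phi> s / of_nat (order G) * cinner x (U s y)"
    have "cinner (isotypic \<phi> x) y = (\<Sum>s\<in>carrier G. ?f (inv s))"
      using \<phi> by (simp add: isotypic_def cinner_sum_left cinner_scaleC_left U_adjoint character_inv)
    also have "\<dots> = (\<Sum>s\<in>carrier G. ?f s)"
      by (rule sum_inverse)
    also have "\<dots> = cinner x (isotypic \<phi> y)"
      by (simp add: isotypic_def cinner_sum_right cinner_scaleC_right)
    finally show ?thesis .
  qed
  ultimately show ?thesis
    by (simp add: orthogonal_projection_def isotypic_bounded is_adjoint_def fun_eq_iff)
qed

text \<open>Eigenvalues of a nonzero vector are unique, so they inherit multiplicativity from
  \<open>U\<close>.\<close>

lemma joint_eigenvector_character: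
  assumes "x \<noteq> 0" "\<And>s. s \<in> carrier G \<Longrightarrow> \<exists>c. U s x = c *\<^sub>C x"
  obtains \<psi> where "\<psi> \<in> characters G" "\<And>s. s \<in> carrier G \<Longrightarrow> U s x = \<psi> s *\<^sub>C x"
proof -
  obtain c where c: "U s x = c s *\<^sub>C x" if "s \<in> carrier G" for s
    using assms(2) by metis
  \<comment> \<open>The restriction provides the extensionality that \<open>characters\<close>
    demands.\<close>
  define \<psi> where "\<psi> = restrict c (carrier G)"
  have U: "U s x = \<psi> s *\<^sub>C x" if "s \<in> carrier G" for s
    using c that by (simp add: \<psi>_def)
  have "\<psi> \<one> *\<^sub>C x = 1 *\<^sub>C x"
    using U_one U[of \<one>] by simp
  then have "\<psi> \<one> = 1"
    using assms(1) by (simp only: complex_vector.scale_cancel_right) simp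
  moreover have "\<psi> (s \<otimes> t) = \<psi> s * \<psi> t" if "s \<in> carrier G" "t \<in> carrier G" for s t
  proof -
    have "\<psi> (s \<otimes> t) *\<^sub>C x = (\<psi> s * \<psi> t) *\<^sub>C x"
      using that U_mult[of s t x] U[of s] U[of t] U[of "s \<otimes> t"]
      by (simp add: U_scaleC mult.commute del: complex_vector.scale_cancel_right)
    then show ?thesis
      using assms(1) by simp
  qed
  ultimately have "\<psi> \<in> characters G"
    by (simp add: characters_def \<psi>_def)
  with U show ?thesis
    using that by blast
qed

lemma sum_isotypic: "(\<Sum>\<phi>\<in>characters G. isotypic \<phi> x) = x"
proof (induction x rule: joint_eigenvector_induct)
  case (1 I f)
  have "(\<Sum>\<phi>\<in>characters G. isotypic \<phi> (\<Sum>i\<in>I. f i)) =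
      (\<Sum>i\<in>I. \<Sum>\<phi>\<in>characters G. isotypic \<phi> (f i))"
    by (subst sum.swap) (simp add: linear_sum bounded_operators_linear isotypic_bounded)
  with 1 show ?case by simp
next
  \<comment> \<open>A nonzero joint eigenvector is fixed by the projection of its own character and
    killed by all others; the zero vector determines no character and is treated apart.\<close>
  case (2 x)
  show ?case
  proof (cases "x = 0")
    case True
    then show ?thesis
      by (simp add: linear_0 bounded_operators_linear isotypic_bounded)
  next
    case False
    then obtain \<psi> where \<psi>: "\<psi> \<in> characters G" "\<And>s. s \<in> carrier G \<Longrightarrow> U s x = \<psi> s *\<^sub>C x"
      using joint_eigenvector_character 2 by metis
    then have "(\<Sum>\<phi>\<in>characters G. isotypic \<phi> x) = (\<Sum>\<phi>\<in>characters G. if \<phi> = \<psi> then x else 0)"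
      by (intro sum.cong refl isotypic_eigenvector)
    then show ?thesis
      using \<psi> finite_characters by simp
  qed
qed

section \<open>Assembling the decomposition\<close>

lemma diagonal_decomposition_exists:
  "\<exists>k P lam. diagonal_decomposition G U k P lam \<and> (\<forall>i\<in>{1..k}. P i \<noteq> (\<lambda>x. 0))"
proof -
  \<comment> \<open>Characters that do not occur in \<open>U\<close> are dropped, so that the
    spectrum can be read off. On the zero space \<open>X\<close> is empty and \<open>k\<close> is
    0.\<close>
  define X where "X = {\<phi> \<in> characters G. isotypic \<phi> \<noteq> (\<lambda>x. 0)}"
  have "finite X"
    using finite_characters by (simp add: X_def)
  then obtain h where h: "bij_betw h {1..card X} X"
    using ex_bij_betw_nat_finite_1 by blast
  have hX: "h i \<in> X" if "i \<in> {1..card X}" for i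
    using h that by (auto simp: bij_betw_def)
  have sum_h: "(\<Sum>i=1..card X. isotypic (h i) x) = x" for x
  proof -
    have "(\<Sum>i=1..card X. isotypic (h i) x) = (\<Sum>\<phi>\<in>X. isotypic \<phi> x)"
      using h by (rule sum.reindex_bij_betw)
    also have "\<dots> = (\<Sum>\<phi>\<in>characters G. isotypic \<phi> x)"
      using finite_characters by (intro sum.mono_neutral_left) (auto simp: X_def)
    finally show ?thesis
      by (simp add: sum_isotypic)
  qed
  have "U s x = (\<Sum>i=1..card X. h i s *\<^sub>C isotypic (h i) x)" if "s \<in> carrier G" for s x
  proof -
    have "U s x = U s (\<Sum>i=1..card X. isotypic (h i) x)"
      by (simp only: sum_h)
    also have "\<dots> = (\<Sum>i=1..card X. h i s *\<^sub>C isotypic (h i) x)"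
      using that hX by (simp add: U_sum U_isotypic X_def)
    finally show ?thesis .
  qed
  then have "diagonal_decomposition G U (card X) (\<lambda>i. isotypic (h i)) (\<lambda>i s. h i s)"
    using hX sum_h by (simp add: diagonal_decomposition_def X_def isotypic_projection
        norm_character character_mult)
  moreover have "isotypic (h i) \<noteq> (\<lambda>x. 0)" if "i \<in> {1..card X}" for i
    using hX[OF that] by (simp add: X_def)
  ultimately show ?thesis
    by blast
qed

end

text \<open>A zero projection could carry an arbitrary character and add values outside the
  spectrum, so the spectral formula is asserted for decompositions into nonzero projections,
  together with the existence of one.\<close>

theorem theorem5p3:
  fixes G :: "('g, 'b) monoid_scheme"
    and U :: "'g \<Rightarrow> 'a::chilbert_space \<Rightarrow> 'a"
    and m :: nat
  assumes "group G" and "finite (carrier G)" and "Coset.order G = m"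
    and "U \<in> carrier G \<rightarrow> bounded_operators"
  shows "(commutative_unitary_representation G U \<longleftrightarrow>
            (\<exists>k P lam. diagonal_decomposition G U k P lam)) \<and>
         (commutative_unitary_representation G U \<longrightarrow>
            (\<exists>k P lam. diagonal_decomposition G U k P lam \<and>
               (\<forall>i\<in>{1..k}. P i \<noteq> (\<lambda>x. 0)) \<and>
               (\<forall>s\<in>carrier G. operator_spectrum (U s) = {lam i s | i. i \<in> {1..k}}))) \<and>
         (\<forall>k P lam. diagonal_decomposition G U k P lam \<and> (\<forall>i\<in>{1..k}. P i \<noteq> (\<lambda>x. 0)) \<longrightarrow>
            (\<forall>s\<in>carrier G. operator_spectrum (U s) = {lam i s | i. i \<in> {1..k}}))"
proof -
  have "\<exists>k P lam. diagonal_decomposition G U k P lam \<and> (\<forall>i\<in>{1..k}. P i \<noteq> (\<lambda>x. 0))"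
    if "commutative_unitary_representation G U"
  proof -
    interpret commutative_representation G U
      using assms that
      by (simp add: commutative_representation_def commutative_representation_axioms_def
          finite_group_def finite_group_axioms_def)
    show ?thesis
      by (rule diagonal_decomposition_exists)
  qed
  moreover have "commutative_unitary_representation G U" if "diagonal_decomposition G U k P lam"
    for k P lam
    using assms(1) that by (rule diagonal_decomposition_imp_representation)
  moreover have "\<forall>s\<in>carrier G. operator_spectrum (U s) = {lam i s | i. i \<in> {1..k}}"
    if "diagonal_decomposition G U k P lam" "\<forall>i\<in>{1..k}. P i \<noteq> (\<lambda>x. 0)" for k P lam
    using diagonal_decomposition_spectrum[OF that] by blast
  ultimately show ?thesis
    by (intro conjI iffI impI allI) blast+
qed

end
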